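(* Let $n$ be a positive integer with $n>22$. Then $r(T_n^3,T_n'')=r(T_n^3,T_n''')=r(T_n^3,T_n^3)=2n-8$.
   Context: All graphs are finite simple graphs. For graphs $G_1,G_2$, the Ramsey number $r(G_1,G_2)$ is the smallest positive integer $N$ such that for every graph $G$ on $N$ vertices, either $G$ contains a (not necessarily induced) subgraph isomorphic to $G_1$, or the complement $\overline{G}$ contains a subgraph isomorphic to $G_2$. On vertex set $\{v_0,\ldots,v_{n-1}\}$: $T_n''$ has edges $v_0v_1,\ldots,v_0v_{n-4},v_1v_{n-3},v_1v_{n-2},v_2v_{n-1}$; $T_n'''$ has edges $v_0v_1,\ldots,v_0v_{n-4},v_1v_{n-3},v_2v_{n-2},v_3v_{n-1}$; $T_n^3$ has edges $v_0v_1,\ldots,v_0v_{n-4},v_{n-4}v_{n-3},v_{n-4}v_{n-2},v_{n-4}v_{n-1}$ (the double star whose two adjacent centers have $n-5$ and $3$ further leaves). *)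

theory Defs
  imports "HOL-Library.Ramsey"
begin

text \<open>A graph is a pair of a vertex set and a set of two-element edges.\<close>

type_synonym 'a sgraph = "'a set \<times> 'a set set"

definition finite_simple_graph :: "'a sgraph \<Rightarrow> bool" where
  "finite_simple_graph G \<longleftrightarrow> finite (fst G) \<and> snd G \<subseteq> [fst G]\<^bsup>2\<^esup>"

definition graph_compl :: "'a sgraph \<Rightarrow> 'a sgraph" where
  "graph_compl G = (fst G, [fst G]\<^bsup>2\<^esup> - snd G)"

definition is_subgraph :: "'a sgraph \<Rightarrow> 'a sgraph \<Rightarrow> bool" where
  "is_subgraph H G \<longleftrightarrow> finite_simple_graph H \<and> fst H \<subseteq> fst G \<and> snd H \<subseteq> snd G"

definition graph_isomorphic :: "'a sgraph \<Rightarrow> 'b sgraph \<Rightarrow> bool" where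
  "graph_isomorphic G H \<longleftrightarrow>
     (\<exists>f. bij_betw f (fst G) (fst H) \<and>
       (\<forall>x\<in>fst G. \<forall>y\<in>fst G. {x, y} \<in> snd G \<longleftrightarrow> {f x, f y} \<in> snd H))"

definition contains_copy :: "'a sgraph \<Rightarrow> 'b sgraph \<Rightarrow> bool" where
  "contains_copy G F \<longleftrightarrow> (\<exists>H. is_subgraph H G \<and> graph_isomorphic H F)"

text \<open>Every finite graph is isomorphic to one whose vertices are natural numbers, so
  quantifying over graphs with vertices in \<^typ>\<open>nat\<close> covers all graphs on \<open>N\<close> vertices.
  A suitable \<open>N\<close> always exists by Ramsey's theorem, so the least one is well defined.\<close>

definition ramsey_number :: "'a sgraph \<Rightarrow> 'b sgraph \<Rightarrow> nat" where
  "ramsey_number G1 G2 =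
     (LEAST N. 0 < N \<and>
       (\<forall>G :: nat sgraph. finite_simple_graph G \<and> card (fst G) = N \<longrightarrow>
          contains_copy G G1 \<or> contains_copy (graph_compl G) G2))"

text \<open>The vertex \<open>v\<^sub>i\<close> is represented by the number \<open>i\<close>; the subtractions in the following
  definitions are the intended ones, and the three graphs are trees, when \<open>n\<close> is at least 7.\<close>

definition tree_T2 :: "nat \<Rightarrow> nat sgraph" where
  "tree_T2 n = ({0..n - 1},
     {{0, i} | i. i \<in> {1..n - 4}} \<union> {{1, n - 3}, {1, n - 2}, {2, n - 1}})"

definition tree_T3 :: "nat \<Rightarrow> nat sgraph" where
  "tree_T3 n = ({0..n - 1},
     {{0, i} | i. i \<in> {1..n - 4}} \<union> {{1, n - 3}, {2, n - 2}, {3, n - 1}})"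

definition double_star_T3 :: "nat \<Rightarrow> nat sgraph" where
  "double_star_T3 n = ({0..n - 1},
     {{0, i} | i. i \<in> {1..n - 4}} \<union> {{n - 4, n - 3}, {n - 4, n - 2}, {n - 4, n - 1}})"

text \<open>\<^const>\<open>tree_T2\<close>, \<^const>\<open>tree_T3\<close> and \<^const>\<open>double_star_T3\<close> are the trees usually written
  \<open>T\<^sub>n''\<close>, \<open>T\<^sub>n'''\<close> and \<open>T\<^sub>n\<^sup>3\<close>, respectively.\<close>

end

theory Submission
  imports Defs
begin

text \<open>Write \<open>m = n - 4\<close>, so that \<open>2n - 8 = 2m\<close> and all three trees consist of a star with \<open>m\<close> leaves
  and three further pendant vertices. On \<open>2m\<close> vertices every vertex has red or blue degree at least
  \<open>m\<close>. If red contains no double star and \<open>v\<close> has red degree at least \<open>m\<close>, then every red neighbour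
  of \<open>v\<close> has at most two red neighbours outside the closed red neighbourhood of \<open>v\<close>, so blue is
  almost complete between \<open>W\<close>, the red neighbourhood of \<open>v\<close>, and the remaining vertices \<open>U\<close>, and
  contains all three trees. (From red degree \<open>m + 3\<close> on, vertices of \<open>W\<close> even have red degree at most 3.) If every red degree is less than \<open>m\<close>, then blue has minimum degree at
  least \<open>m\<close>: exchanging the colours gives the blue double star, and a direct matching argument
  gives the two other trees.

  For the lower bound, \<open>2m - 1\<close> vertices admit an \<open>(m - 1)\<close>-regular graph with \<open>(m - 1)\<close>-regular
  complement when \<open>m\<close> is odd. When \<open>m\<close> is even parity forces an exception, and a single vertex of
  degree \<open>m\<close> is tolerated, each of whose neighbours has at most two neighbours outside.\<close>

section \<open>Trees as configurations of neighbourhoods\<close>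

definition nbhd :: "'a set set \<Rightarrow> 'a \<Rightarrow> 'a set" where
  "nbhd E x = {y. {x, y} \<in> E}"

text \<open>A neighbourhood function stands for the graph, so both colours are treated alike and no
  vertex numbering is needed.\<close>

definition has_double_star :: "('a \<Rightarrow> 'a set) \<Rightarrow> nat \<Rightarrow> bool" where
  "has_double_star N m \<longleftrightarrow> (\<exists>v S a X. S \<subseteq> N v \<and> card S = m \<and> a \<in> S \<and>
     X \<subseteq> N a \<and> card X = 3 \<and> X \<inter> insert v S = {})"

definition has_T2 :: "('a \<Rightarrow> 'a set) \<Rightarrow> nat \<Rightarrow> bool" where
  "has_T2 N m \<longleftrightarrow> (\<exists>v S a b x y z. S \<subseteq> N v \<and> card S = m \<and> {a, b} \<subseteq> S \<and> a \<noteq> b \<and>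
     x \<in> N a \<and> y \<in> N a \<and> z \<in> N b \<and> distinct [x, y, z] \<and> {x, y, z} \<inter> insert v S = {})"

definition has_T3 :: "('a \<Rightarrow> 'a set) \<Rightarrow> nat \<Rightarrow> bool" where
  "has_T3 N m \<longleftrightarrow> (\<exists>v S a b c x y z. S \<subseteq> N v \<and> card S = m \<and> {a, b, c} \<subseteq> S \<and>
     distinct [a, b, c] \<and> x \<in> N a \<and> y \<in> N b \<and> z \<in> N c \<and> distinct [x, y, z] \<and>
     {x, y, z} \<inter> insert v S = {})"

definition has_all_trees :: "('a \<Rightarrow> 'a set) \<Rightarrow> nat \<Rightarrow> bool" where
  "has_all_trees N m \<longleftrightarrow> has_double_star N m \<and> has_T2 N m \<and> has_T3 N m"

lemma obtain_card_between:
  assumes "finite C" "A \<subseteq> C" "card A \<le> k" "k \<le> card C"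
  obtains S where "A \<subseteq> S" "S \<subseteq> C" "card S = k"
  using exists_subset_between[OF assms(3,4,2,1)] by blast

lemma obtain_notin_finite:
  assumes "finite A" "card A < card N"
  obtains x where "x \<in> N" "x \<notin> A"
  using assms by (meson card_mono not_le subsetI)

text \<open>Double counting of the adjacent pairs in \<open>U \<times> W\<close>.\<close>

lemma sum_card_nbrs_swap:
  assumes "finite U" "finite W" and sym: "\<And>x y. y \<in> N x \<longleftrightarrow> x \<in> N y"
  shows "(\<Sum>u\<in>U. card (N u \<inter> W)) = (\<Sum>w\<in>W. card (N w \<inter> U))"
proof -
  have "(\<Sum>u\<in>U. card (N u \<inter> W)) = (\<Sum>u\<in>U. card {w\<in>W. w \<in> N u})"
    by (intro sum.cong refl arg_cong[where f = card]) auto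
  also have "\<dots> = (\<Sum>w\<in>W. card {u\<in>U. w \<in> N u})"
    using sum_multicount_gen[of U W "\<lambda>u w. w \<in> N u" "\<lambda>w. card {u\<in>U. w \<in> N u}"] assms by simp
  also have "\<dots> = (\<Sum>w\<in>W. card (N w \<inter> U))"
    by (intro sum.cong refl arg_cong[where f = card]) (use sym in auto)
  finally show ?thesis .
qed

text \<open>One star serves all three trees. The pendants are chosen greedily: at most two outside
  vertices are taken before each choice, and every branching leaf offers three.\<close>

lemma has_all_trees_if_three_branching:
  assumes S: "S \<subseteq> N v" "card S = m" and A: "A \<subseteq> S" "3 \<le> card A"
    and out: "\<And>a. a \<in> A \<Longrightarrow> 3 \<le> card (N a - insert v S)"
  shows "has_all_trees N m"
proof -
  obtain A' where "A' \<subseteq> A" "card A' = 3"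
    using A(2) obtain_subset_with_card_n by metis
  then obtain a b c where abc: "{a, b, c} \<subseteq> A" "distinct [a, b, c]"
    by (auto simp: card_Suc_eq numeral_3_eq_3)
  obtain X where X: "X \<subseteq> N a - insert v S" "card X = 3"
    using out[of a] abc obtain_subset_with_card_n by (metis insert_subset)
  have ds: "has_double_star N m"
    unfolding has_double_star_def
    by (rule exI[of _ v], rule exI[of _ S], rule exI[of _ a], rule exI[of _ X]) (use S X abc A in auto)
  obtain x y where xy: "{x, y} \<subseteq> X" "x \<noteq> y"
    using X(2) by (auto simp: card_Suc_eq numeral_3_eq_3)
  obtain z where z: "z \<in> N b - insert v S" "z \<notin> {x, y}"
    by (rule obtain_notin_finite[of "{x, y}" "N b - insert v S"]) (use out[of b] abc xy in auto)
  have t2: "has_T2 N m"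
    unfolding has_T2_def
    by (rule exI[of _ v], rule exI[of _ S], rule exI[of _ a], rule exI[of _ b], rule exI[of _ x],
        rule exI[of _ y], rule exI[of _ z]) (use S X abc A xy z in auto)
  obtain y' where y': "y' \<in> N c - insert v S" "y' \<notin> {x, z}"
    by (rule obtain_notin_finite[of "{x, z}" "N c - insert v S"]) (use out[of c] abc z in auto)
  have "has_T3 N m"
    unfolding has_T3_def
    by (rule exI[of _ v], rule exI[of _ S], rule exI[of _ a], rule exI[of _ b], rule exI[of _ c],
        rule exI[of _ x], rule exI[of _ z], rule exI[of _ y']) (use S X abc A xy z y' in auto)
  with ds t2 show ?thesis by (simp add: has_all_trees_def)
qed

section \<open>Two-colourings on an even number of vertices\<close>

locale two_colouring =
  fixes V :: "'a set" and R B :: "'a \<Rightarrow> 'a set" and m :: nat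
  assumes finite_V: "finite V" and card_V: "card V = 2 * m" and m_ge: "19 \<le> m"
    and R_sub: "R x \<subseteq> V" and B_sub: "B x \<subseteq> V"
    and R_sym: "y \<in> R x \<Longrightarrow> x \<in> R y" and B_sym: "y \<in> B x \<Longrightarrow> x \<in> B y"
    and RB_Un: "x \<in> V \<Longrightarrow> R x \<union> B x = V - {x}" and RB_disj: "R x \<inter> B x = {}"
begin

lemma swap_colours: "two_colouring V B R m"
  by unfold_locales
    (use finite_V card_V m_ge R_sub B_sub R_sym B_sym RB_Un RB_disj in \<open>simp_all add: Un_commute Int_commute\<close>)

lemma fin: "A \<subseteq> V \<Longrightarrow> finite A"
  using finite_V finite_subset by auto

lemma fin_R: "finite (R x)" and fin_B: "finite (B x)"
  using fin R_sub B_sub by auto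

lemma R_irrefl: "x \<notin> R x"
  using R_sub[of x] RB_Un[of x] by blast

lemma B_eq: "x \<in> V \<Longrightarrow> B x = V - insert x (R x)"
  using RB_Un[of x] RB_disj[of x] by blast

lemma card_RB: assumes "x \<in> V" shows "card (R x) + card (B x) = 2 * m - 1"
proof -
  have "card (R x) + card (B x) = card (R x \<union> B x)"
    using RB_disj fin_R fin_B by (simp add: card_Un_disjoint)
  then show ?thesis using RB_Un[OF assms] assms card_V finite_V by simp
qed

text \<open>Three such neighbours of \<open>w\<close> would be the pendants of a red double star
  with centres \<open>v\<close> and \<open>w\<close>, once \<open>R v\<close> is trimmed to
  \<open>m\<close> leaves including \<open>w\<close>.\<close>

lemma card_outside:
  assumes nods: "\<not> has_double_star R m" and deg: "m \<le> card (R v)" and w: "w \<in> R v"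
  shows "card (R w - insert v (R v)) \<le> 2"
proof (rule ccontr)
  assume "\<not> ?thesis"
  then obtain X where X: "X \<subseteq> R w - insert v (R v)" "card X = 3"
    using obtain_subset_with_card_n[of 3 "R w - insert v (R v)"] by auto
  obtain S where S: "{w} \<subseteq> S" "S \<subseteq> R v" "card S = m"
    by (rule obtain_card_between[of "R v" "{w}" m]) (use w deg m_ge fin_R in auto)
  have "has_double_star R m" unfolding has_double_star_def
    by (rule exI[of _ v], rule exI[of _ S], rule exI[of _ w], rule exI[of _ X]) (use S X in auto)
  with nods show False by simp
qed

text \<open>Three surplus neighbours of \<open>v\<close> allow the pendants at \<open>w\<close> to
  lie inside \<open>R v\<close>: after their removal \<open>m\<close> leaves remain,
  \<open>w\<close> among them.\<close>

lemma card_nbhd_of_nbr: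
  assumes nods: "\<not> has_double_star R m" and deg: "m + 3 \<le> card (R v)" and w: "w \<in> R v"
  shows "card (R w) \<le> 3"
proof (rule ccontr)
  assume "\<not> ?thesis"
  then have "3 \<le> card (R w - {v})" using fin_R by (auto simp: card_Diff_singleton_if)
  then obtain X where X: "X \<subseteq> R w - {v}" "card X = 3" "finite X"
    using obtain_subset_with_card_n[of 3 "R w - {v}"] by metis
  have "w \<notin> X" using X(1) R_irrefl by blast
  have "m \<le> card (R v - X)"
    using deg X diff_card_le_card_Diff[of X "R v"] by simp
  then obtain S where S: "{w} \<subseteq> S" "S \<subseteq> R v - X" "card S = m"
    by (rule obtain_card_between[of "R v - X" "{w}" m, rotated 3])
       (use w \<open>w \<notin> X\<close> m_ge fin_R in auto)
  have "has_double_star R m" unfolding has_double_star_def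
    by (rule exI[of _ v], rule exI[of _ S], rule exI[of _ w], rule exI[of _ X]) (use S X in auto)
  with nods show False by simp
qed

text \<open>A leaf in \<open>W\<close> is red to at most two of five free vertices of
  \<open>U\<close>, so three are left as blue pendants.\<close>

lemma has_all_trees_across:
  assumes few: "\<And>w. w \<in> W \<Longrightarrow> card (R w \<inter> U) \<le> 2" and UV: "U \<subseteq> V" "U \<inter> W = {}"
    and WV: "W \<subseteq> V"
    and S: "S \<subseteq> B c" "card S = m" "3 \<le> card (S \<inter> W)" and U: "5 \<le> card (U - insert c S)"
  shows "has_all_trees B m"
proof (rule has_all_trees_if_three_branching[where N = B and v = c and S = S and A = "S \<inter> W"])
  fix a assume a: "a \<in> S \<inter> W"
  have "(U - insert c S) - (R a \<inter> U) \<subseteq> B a - insert c S"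
    using a UV WV B_eq[of a] by auto
  then have "card ((U - insert c S) - (R a \<inter> U)) \<le> card (B a - insert c S)"
    by (intro card_mono) (auto simp: fin_B)
  moreover have "card (U - insert c S) - card (R a \<inter> U) \<le> card ((U - insert c S) - (R a \<inter> U))"
    using diff_card_le_card_Diff fin_R by blast
  ultimately show "3 \<le> card (B a - insert c S)" using few[of a] a U by auto
qed (use S in auto)

text \<open>A red neighbour \<open>w\<close> of \<open>v\<close> serves as blue centre. All of
  \<open>R v\<close> has red degree at most 3, so \<open>w\<close> has blue leaves in
  \<open>R v\<close>, and each of these is blue to almost everything else.\<close>

lemma has_all_trees_if_huge_degree:
  assumes nods: "\<not> has_double_star R m" and deg: "m + 3 \<le> card (R v)"
  shows "has_all_trees B m"
proof -
  have "R v \<noteq> {}" using deg by auto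
  then obtain w where w: "w \<in> R v" by blast
  have wV: "w \<in> V" using w R_sub by blast
  note c3 = card_nbhd_of_nbr[OF nods deg]
  have "card (R v) \<le> card ((R v \<inter> B w) \<union> insert w (R w))"
    by (intro card_mono) (use B_eq[OF wV] fin_R fin_B R_sub[of v] in auto)
  also have "\<dots> \<le> card (R v \<inter> B w) + (card (R w) + 1)"
    using card_Un_le[of "R v \<inter> B w" "insert w (R w)"] R_irrefl[of w] fin_R by simp
  finally have "3 \<le> card (R v \<inter> B w)" using deg c3[OF w] m_ge by simp
  then obtain A where A: "A \<subseteq> R v \<inter> B w" "card A = 3"
    using obtain_subset_with_card_n by metis
  obtain S where S: "A \<subseteq> S" "S \<subseteq> B w" "card S = m"
    by (rule obtain_card_between[of "B w" A m])
       (use A m_ge fin_B c3[OF w] card_RB[OF wV] in auto)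
  show ?thesis
  proof (rule has_all_trees_if_three_branching[where N = B and v = w and S = S and A = A])
    fix a assume a: "a \<in> A"
    have aV: "a \<in> V" and aR: "a \<in> R v" using a A R_sub by auto
    have "V - insert w S - R a \<subseteq> B a - insert w S"
      using B_eq[OF aV] S(1) a by auto
    then have "card (V - insert w S - R a) \<le> card (B a - insert w S)"
      by (intro card_mono) (auto simp: fin_B)
    moreover have "card V - card (insert w S) \<le> card (V - insert w S)"
      using diff_card_le_card_Diff S(2) fin_B finite_subset by (metis finite.insertI)
    moreover have "card (V - insert w S) - card (R a) \<le> card (V - insert w S - R a)"
      using diff_card_le_card_Diff fin_R by blast
    moreover have "card (insert w S) \<le> m + 1" using S(3) card_insert_le_m1[of "m+1" S w] by simp
    ultimately show "3 \<le> card (B a - insert w S)" using c3[OF aR] m_ge card_V by linarith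
  qed (use A S in auto)
qed

text \<open>Averaging gives a \<open>u\<close> in \<open>U\<close> with at most two red neighbours
  in \<open>W\<close>; its blue star on \<open>v\<close> and \<open>W - R u\<close> has at least
  \<open>m - 1\<close> leaves. A missing leaf is sought in \<open>U\<close>, and failing that the
  centre moves to some \<open>w\<close> in \<open>W\<close>.\<close>

lemma has_all_trees_if_large_degree:
  assumes nods: "\<not> has_double_star R m" and v: "v \<in> V" and deg: "m \<le> card (R v)"
    and deg_le: "card (R v) \<le> m + 2"
  shows "has_all_trees B m"
proof -
  define W where "W = R v"
  define U where "U = B v"
  have WV: "W \<subseteq> V" and UV: "U \<subseteq> V" and UW: "U \<inter> W = {}" 
    using R_sub[of v] B_sub[of v] RB_disj[of v] by (auto simp: W_def U_def)
  have finW: "finite W" and finU: "finite U" using fin WV UV by auto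
  have U_eq: "U = V - insert v W" using B_eq[OF v] by (simp add: U_def W_def)
  have cWU: "card W + card U = 2 * m - 1" using card_RB[OF v] by (simp add: W_def U_def)
  have cW: "m \<le> card W" "card W \<le> m + 2" using deg deg_le by (auto simp: W_def)
  have few: "card (R w \<inter> U) \<le> 2" if "w \<in> W" for w
  proof -
    have "card (R w \<inter> U) \<le> card (R w - insert v (R v))"
      by (intro card_mono) (use U_eq W_def fin_R in auto)
    with card_outside[OF nods deg, of w] that show ?thesis by (simp add: W_def)
  qed
  note across = has_all_trees_across[OF few UV UW WV]
  have "(\<Sum>u\<in>U. card (R u \<inter> W)) = (\<Sum>w\<in>W. card (R w \<inter> U))"
    using sum_card_nbrs_swap[OF finU finW] R_sym by blast
  also have "\<dots> \<le> 2 * card W"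
    using sum_bounded_above[of W "\<lambda>w. card (R w \<inter> U)" 2] few by simp
  finally have sum_le: "(\<Sum>u\<in>U. card (R u \<inter> W)) \<le> 2 * card W" .
  \<comment> \<open>Otherwise \<open>3 * card U \<le> 2 * card W\<close>, against
    \<open>card W \<le> m + 2\<close> and \<open>card U \<ge> m - 3\<close>.\<close>
  have "\<exists>u\<in>U. card (R u \<inter> W) \<le> 2"
  proof (rule ccontr)
    assume "\<not> ?thesis"
    then have "\<And>u. u \<in> U \<Longrightarrow> 3 \<le> card (R u \<inter> W)" by force
    then have "3 * card U \<le> (\<Sum>u\<in>U. card (R u \<inter> W))"
      using sum_bounded_below[of U 3 "\<lambda>u. card (R u \<inter> W)"] by simp
    with sum_le cW cWU m_ge show False by linarith
  qed
  then obtain u where u: "u \<in> U" "card (R u \<inter> W) \<le> 2" by blast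
  have uV: "u \<in> V" "u \<noteq> v" "u \<notin> W" using u U_eq by auto
  define P where "P = insert v (W - R u)"
  have vW: "v \<notin> W" using R_irrefl by (simp add: W_def)
  have vu: "v \<in> B u" using u B_sym by (simp add: U_def)
  have PB: "P \<subseteq> B u" using vu uV WV B_eq[OF uV(1)] by (auto simp: P_def)
  have "card (W - R u) = card W - card (R u \<inter> W)"
    using card_Diff_subset_Int[of W "R u"] finW by (simp add: Int_commute)
  moreover have "card P = card (W - R u) + 1" using vW finW by (simp add: P_def)
  ultimately have cP: "card P + card (R u \<inter> W) = card W + 1" using u cW m_ge by linarith
  have finP: "finite P" using PB fin_B finite_subset by auto
  have PW: "W - R u = P - {v}" using vW by (auto simp: P_def)
  show ?thesis
  proof (cases "m \<le> card P")
    case True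
    then obtain S where S: "S \<subseteq> P" "card S = m"
      using obtain_subset_with_card_n by metis
    show ?thesis
    proof (rule across[of S u])
      have "S - {v} \<subseteq> S \<inter> W" using S(1) PW by auto
      then have "card (S - {v}) \<le> card (S \<inter> W)" by (intro card_mono) (use finW in auto)
      then show "3 \<le> card (S \<inter> W)" using S(2) m_ge by (simp add: card_Diff_singleton_if split: if_splits)
      have "U - {u} \<subseteq> U - insert u S" using S(1) U_eq UW by (auto simp: P_def)
      then have "card (U - {u}) \<le> card (U - insert u S)" by (intro card_mono) (use finU in auto)
      then show "5 \<le> card (U - insert u S)" using u cW cWU m_ge by simp
    qed (use S PB in auto)
  next
    case False
    \<comment> \<open>\<open>card P = card W + 1 - card (R u \<inter> W)\<close> is below
      \<open>m\<close> only if both bounds are tight, and then by exactly one.\<close>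
    then have eqs: "card W = m" "card (R u \<inter> W) = 2" "card P = m - 1" using cP u cW by auto
    show ?thesis
    proof (cases "\<exists>x. x \<in> B u \<inter> U")
      case True
      then obtain x where x: "x \<in> B u" "x \<in> U" by blast
      have xP: "x \<notin> P" using x U_eq by (auto simp: P_def)
      show ?thesis
      proof (rule across[of "insert x P" u])
        show "insert x P \<subseteq> B u" using x PB by auto
        show "card (insert x P) = m" using xP finP eqs m_ge by simp
        have "card (P - {v}) \<le> card (insert x P \<inter> W)" 
          by (intro card_mono) (use finW PW in auto)
        then show "3 \<le> card (insert x P \<inter> W)"
          using eqs m_ge by (simp add: card_Diff_singleton_if split: if_splits)
        have "U - {u, x} \<subseteq> U - insert u (insert x P)" using U_eq UW by (auto simp: P_def)
        then have "card (U - {u, x}) \<le> card (U - insert u (insert x P))"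
          by (intro card_mono) (use finU in auto)
        moreover have "card U - card {u, x} \<le> card (U - {u, x})"
          by (rule diff_card_le_card_Diff) simp
        moreover have "card {u, x} \<le> 2" by (simp add: card_insert_if)
        ultimately show "5 \<le> card (U - insert u (insert x P))" using eqs cWU m_ge by linarith
      qed
    next
      case False
      \<comment> \<open>Now \<open>u\<close> is itself red-big, which bounds the red degree of its red neighbours \<open>w \<in> W\<close>;
        such a \<open>w\<close> serves as the blue centre.\<close>
      have Ru: "R u = (U - {u}) \<union> (R u \<inter> W)"
        using False B_eq[OF uV(1)] vu RB_disj[of u] R_sub[of u] R_irrefl[of u] U_eq UV by blast
      have "card (R u) = card (U - {u}) + card (R u \<inter> W)"
        by (subst Ru, rule card_Un_disjoint) (use finU finW UW in auto)
      then have deg_u: "m \<le> card (R u)" using u eqs cWU m_ge by simp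
      obtain w where w: "w \<in> R u" "w \<in> W" using eqs(2) by (metis Int_iff all_not_in_conv card.empty zero_neq_numeral)
      have wV: "w \<in> V" using w WV by auto
      \<comment> \<open>Each of the three sets has at most two elements: the first because
        \<open>u\<close> is red-big, the second by \<open>few\<close>, the third by
        \<open>eqs\<close>.\<close>
      have "R w \<subseteq> (R w - insert u (R u)) \<union> (R w \<inter> U) \<union> (R u \<inter> W)"
        using Ru u(1) by blast
      then have "card (R w) \<le> card ((R w - insert u (R u)) \<union> (R w \<inter> U) \<union> (R u \<inter> W))"
        by (intro card_mono) (use fin_R in auto)
      also have "\<dots> \<le> card (R w - insert u (R u)) + card (R w \<inter> U) + card (R u \<inter> W)"
        by (meson add_le_mono card_Un_le le_refl order_trans)
      also have "\<dots> \<le> 6"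
        using card_outside[OF nods deg_u w(1)] few[OF w(2)] eqs(2) by simp
      finally have Rw: "card (R w) \<le> 6" .
      have BwW: "W - insert w (R w) \<subseteq> B w \<inter> W" using B_eq[OF wV] WV by auto
      \<comment> \<open>\<open>W\<close> loses \<open>w\<close> and at most six red neighbours of
        \<open>w\<close>, hence the 7 below.\<close>
      have "card W - card (insert w (R w)) \<le> card (W - insert w (R w))"
        by (rule diff_card_le_card_Diff) (use fin_R in auto)
      also have "\<dots> \<le> card (B w \<inter> W)" using BwW by (intro card_mono) (use finW in auto)
      finally have cBW: "m - 7 \<le> card (B w \<inter> W)"
        using Rw eqs R_irrefl[of w] fin_R by simp
      have "card (B w \<inter> W) \<le> m" using eqs card_mono[OF finW, of "B w \<inter> W"] by simp
      then obtain S where S: "B w \<inter> W \<subseteq> S" "S \<subseteq> B w" "card S = m"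
        by (rule obtain_card_between[of "B w" "B w \<inter> W" m, rotated 2])
           (use fin_B Rw card_RB[OF wV] m_ge in auto)
      have finS: "finite S" using S(2) fin_B finite_subset by auto
      have SW: "m - 7 \<le> card (S \<inter> W)"
        using cBW card_mono[of "S \<inter> W" "B w \<inter> W"] S(1) finW by auto
      show ?thesis
      proof (rule across[OF _ S(2,3)])
        show "3 \<le> card (S \<inter> W)" using SW m_ge by simp
        \<comment> \<open>At most seven leaves lie outside \<open>W\<close>, so all but seven of the
          \<open>m - 1\<close> vertices of \<open>U\<close> stay free for pendants.\<close>
        have "card S = card (S \<inter> W) + card (S - W)" using card_Int_Diff[OF finS] by simp
        then have "card (S - W) \<le> 7" using S(3) SW m_ge by linarith
        moreover have "card U - card (S - W) \<le> card (U - (S - W))"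
          by (rule diff_card_le_card_Diff) (use finS in auto)
        moreover have "card (U - (S - W)) \<le> card (U - insert w S)"
          by (intro card_mono) (use finU UW w in auto)
        ultimately show "5 \<le> card (U - insert w S)" using eqs cWU m_ge by linarith
      qed
    qed
  qed
qed

lemma has_all_trees_if_big_vertex:
  assumes "\<not> has_double_star R m" "v \<in> V" "m \<le> card (R v)"
  shows "has_all_trees B m"
  using assms has_all_trees_if_huge_degree[of v] has_all_trees_if_large_degree[of v]
  by linarith

end

section \<open>Graphs of minimum degree at least half the order\<close>

locale dense_graph =
  fixes V :: "'a set" and N :: "'a \<Rightarrow> 'a set" and m :: nat
  assumes finite_V: "finite V" and card_V: "card V = 2 * m" and m_ge: "19 \<le> m"
    and N_sub: "N x \<subseteq> V - {x}" and N_sym: "y \<in> N x \<longleftrightarrow> x \<in> N y"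
    and min_degree: "x \<in> V \<Longrightarrow> m \<le> card (N x)"
begin

lemma finite_N: "finite (N x)"
  using N_sub[of x] finite_V finite_subset by auto

text \<open>With three neighbours to spare, the pendants may be chosen first, even in
  \<open>N v\<close>; the star is then cut out of what remains.\<close>

lemma has_T2_T3_if_huge_degree:
  assumes deg: "m + 3 \<le> card (N v)"
  shows "has_T2 N m \<and> has_T3 N m"
proof -
  obtain A where "A \<subseteq> N v" "card A = 3"
    using obtain_subset_with_card_n[of 3 "N v"] deg by auto
  then obtain a b c where abc: "{a, b, c} \<subseteq> N v" "distinct [a, b, c]"
    by (auto simp: card_Suc_eq numeral_3_eq_3)
  \<comment> \<open>\<open>q\<close> and \<open>r\<close> are the leaves carrying the second and
    third pendant: \<open>a\<close>, \<open>b\<close> for \<open>has_T2\<close> and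
    \<open>b\<close>, \<open>c\<close> for \<open>has_T3\<close>.\<close>
  have pick: "\<exists>x y z S. x \<in> N a \<and> y \<in> N q \<and> z \<in> N r \<and> distinct [x, y, z] \<and> S \<subseteq> N v \<and>
      card S = m \<and> {a, b, c} \<subseteq> S \<and> {x, y, z} \<inter> insert v S = {}"
    if qr: "{q, r} \<subseteq> {a, b, c}" for q r
  proof -
    have inV: "{a, q, r} \<subseteq> V" using qr abc(1) N_sub[of v] by auto
    \<comment> \<open>The last choice below has to avoid up to six vertices.\<close>
    have 7: "7 \<le> card (N a)" "7 \<le> card (N q)" "7 \<le> card (N r)"
      using inV min_degree[of a] min_degree[of q] min_degree[of r] m_ge by auto
    obtain x where x: "x \<in> N a" "x \<notin> {v, a, b, c}"
      by (rule obtain_notin_finite[of "{v, a, b, c}" "N a"])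
         (use 7 card_length[of "[v, a, b, c]"] in simp_all)
    obtain y where y: "y \<in> N q" "y \<notin> {v, a, b, c, x}"
      by (rule obtain_notin_finite[of "{v, a, b, c, x}" "N q"])
         (use 7 card_length[of "[v, a, b, c, x]"] in simp_all)
    obtain z where z: "z \<in> N r" "z \<notin> {v, a, b, c, x, y}"
      by (rule obtain_notin_finite[of "{v, a, b, c, x, y}" "N r"])
         (use 7 card_length[of "[v, a, b, c, x, y]"] in simp_all)
    have "card {x, y, z} = 3" using x y z by auto
    then have "m \<le> card (N v - {x, y, z})"
      using deg diff_card_le_card_Diff[of "{x, y, z}" "N v"] by simp
    then obtain S where S: "{a, b, c} \<subseteq> S" "S \<subseteq> N v - {x, y, z}" "card S = m"
      by (rule obtain_card_between[of "N v - {x, y, z}" "{a, b, c}" m, rotated 3])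
         (use finite_N abc x y z m_ge in auto)
    show ?thesis
      by (rule exI[of _ x], rule exI[of _ y], rule exI[of _ z], rule exI[of _ S])
         (use x y z S in auto)
  qed
  have "has_T2 N m"
  proof -
    from pick[of a b] obtain x y z S where xyz: "x \<in> N a" "y \<in> N a" "z \<in> N b" "distinct [x, y, z]" "S \<subseteq> N v"
      "card S = m" "{a, b, c} \<subseteq> S" "{x, y, z} \<inter> insert v S = {}" by auto
    show ?thesis unfolding has_T2_def
      by (rule exI[of _ v], rule exI[of _ S], rule exI[of _ a], rule exI[of _ b],
          rule exI[of _ x], rule exI[of _ y], rule exI[of _ z])
         (use abc xyz in auto)
  qed
  moreover have "has_T3 N m"
  proof -
    from pick[of b c] obtain x y z S where xyz: "x \<in> N a" "y \<in> N b" "z \<in> N c" "distinct [x, y, z]" "S \<subseteq> N v"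
      "card S = m" "{a, b, c} \<subseteq> S" "{x, y, z} \<inter> insert v S = {}" by auto
    show ?thesis unfolding has_T3_def
      by (rule exI[of _ v], rule exI[of _ S], rule exI[of _ a], rule exI[of _ b], rule exI[of _ c],
          rule exI[of _ x], rule exI[of _ y], rule exI[of _ z])
         (use abc xyz in auto)
  qed
  ultimately show ?thesis ..
qed

text \<open>Any \<open>v\<close> can be the centre: each vertex of \<open>U\<close>, the
  non-neighbours of \<open>v\<close>, has two neighbours in \<open>W = N v\<close>. Counting these
  edges gives \<open>has_T2\<close>; a matching of three vertices of \<open>U\<close> into
  \<open>W\<close> gives \<open>has_T3\<close>.\<close>

lemma has_T2_T3_if_bounded_degree:
  assumes bounded: "\<And>x. card (N x) \<le> m + 2"
  shows "has_T2 N m \<and> has_T3 N m"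
proof -
  have "V \<noteq> {}" using card_V m_ge by auto
  then obtain v where v: "v \<in> V" by blast
  define W where "W = N v"
  define U where "U = V - insert v W"
  have WV: "W \<subseteq> V" "v \<notin> W" using N_sub[of v] by (auto simp: W_def)
  have finW: "finite W" and finU: "finite U" using finite_N finite_V by (auto simp: W_def U_def)
  have "card U = card V - card (insert v W)"
    unfolding U_def using finW WV v by (intro card_Diff_subset) auto
  then have cU: "card U = 2 * m - 1 - card W" using card_V WV finW by simp
  have cW: "m \<le> card W" "card W \<le> m + 2" using min_degree[OF v] bounded by (auto simp: W_def)
  have UW: "U \<inter> W = {}" "v \<notin> U" by (auto simp: U_def)
  \<comment> \<open>At most \<open>card U - 1 = 2 * m - 2 - card W\<close> neighbours of
    \<open>u\<close> lie in \<open>U\<close>, and \<open>v\<close> is not one; the rest of the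
    degree goes to \<open>W\<close>.\<close>
  have to_W: "card W - m + 2 \<le> card (N u \<inter> W)" if u: "u \<in> U" for u
  proof -
    have "v \<notin> N u" using u N_sym[of v u] by (auto simp: U_def W_def)
    then have "N u \<subseteq> (U - {u}) \<union> (N u \<inter> W)" using N_sub[of u] by (auto simp: U_def)
    then have "card (N u) \<le> card ((U - {u}) \<union> (N u \<inter> W))"
      by (intro card_mono) (use finU finW in auto)
    also have "\<dots> \<le> card (U - {u}) + card (N u \<inter> W)" by (rule card_Un_le)
    finally show ?thesis using u min_degree[of u] cU cW m_ge by (simp add: U_def)
  qed
  then have two: "2 \<le> card (N u \<inter> W)" if "u \<in> U" for u using that by fastforce
  have other: "\<exists>s\<in>N u \<inter> W. s \<noteq> r" if "u \<in> U" for u r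
    using obtain_notin_finite[of "{r}" "N u \<inter> W"] two[OF that] by auto
  have U_new: "\<exists>z\<in>U. z \<noteq> x \<and> z \<noteq> y" for x y
  proof -
    have "card {x, y} \<le> 2" by (simp add: card_insert_if)
    then have "card {x, y} < card U" using cU cW m_ge by linarith
    then show ?thesis using obtain_notin_finite[of "{x, y}" U] by auto
  qed
  have T2: "has_T2 N m"
  proof -
    \<comment> \<open>Otherwise \<open>2 * card U \<le> card W\<close> by double counting, but
      \<open>U\<close> and \<open>W\<close> are nearly equal in size.\<close>
    have "\<exists>a\<in>W. 2 \<le> card (N a \<inter> U)"
    proof (rule ccontr)
      assume "\<not> ?thesis"
      then have "\<And>a. a \<in> W \<Longrightarrow> card (N a \<inter> U) \<le> 1" by force
      then have "(\<Sum>a\<in>W. card (N a \<inter> U)) \<le> card W"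
        using sum_bounded_above[of W "\<lambda>a. card (N a \<inter> U)" 1] by simp
      moreover have "(\<Sum>u\<in>U. card (N u \<inter> W)) = (\<Sum>a\<in>W. card (N a \<inter> U))"
        using sum_card_nbrs_swap[OF finU finW] N_sym by blast
      moreover have "2 * card U \<le> (\<Sum>u\<in>U. card (N u \<inter> W))"
        using sum_bounded_below[of U 2 "\<lambda>u. card (N u \<inter> W)"] two by simp
      ultimately show False using cU cW m_ge by linarith
    qed
    then obtain a where a: "a \<in> W" "2 \<le> card (N a \<inter> U)" by blast
    obtain X where X: "X \<subseteq> N a \<inter> U" "card X = 2"
      using a(2) obtain_subset_with_card_n by metis
    then obtain x y where xy: "{x, y} \<subseteq> N a \<inter> U" "x \<noteq> y" by (auto simp: card_2_iff)
    obtain z where z: "z \<in> U" "z \<noteq> x" "z \<noteq> y" using U_new by blast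
    obtain b where b: "b \<in> N z \<inter> W" "b \<noteq> a" using other[OF z(1)] by blast
    obtain S where S: "{a, b} \<subseteq> S" "S \<subseteq> W" "card S = m"
      by (rule obtain_card_between[of W "{a, b}" m])
         (use a b finW cW m_ge card_length[of "[a, b]"] in simp_all)
    have zb: "z \<in> N b" using b N_sym by blast
    have Sv: "S \<subseteq> N v" using S by (simp add: W_def)
    have out: "{x, y, z} \<inter> insert v S = {}" using S(2) xy(1) z(1) UW by blast
    show ?thesis unfolding has_T2_def
      by (rule exI[of _ v], rule exI[of _ S], rule exI[of _ a], rule exI[of _ b],
          rule exI[of _ x], rule exI[of _ y], rule exI[of _ z])
         (use S(1,3) xy z(2,3) b(2) zb Sv out in auto)
  qed
  \<comment> \<open>Reduces \<open>has_T3\<close> to a matching of three vertices of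
    \<open>U\<close> into \<open>W\<close>.\<close>
  have T3I: "has_T3 N m" if abc: "a \<in> N x \<inter> W" "b \<in> N y \<inter> W" "c \<in> N z \<inter> W" "distinct [a, b, c]"
    "{x, y, z} \<subseteq> U" "distinct [x, y, z]" for a b c x y z
  proof -
    obtain S where S: "{a, b, c} \<subseteq> S" "S \<subseteq> W" "card S = m"
      by (rule obtain_card_between[of W "{a, b, c}" m])
         (use abc(1-3) finW cW m_ge card_length[of "[a, b, c]"] in simp_all)
    have nb: "x \<in> N a" "y \<in> N b" "z \<in> N c" using abc(1-3) N_sym by blast+
    have Sv: "S \<subseteq> N v" using S by (simp add: W_def)
    have out: "{x, y, z} \<inter> insert v S = {}" using S(2) abc(5) UW by blast
    show ?thesis unfolding has_T3_def
      by (rule exI[of _ v], rule exI[of _ S], rule exI[of _ a], rule exI[of _ b], rule exI[of _ c],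
          rule exI[of _ x], rule exI[of _ y], rule exI[of _ z])
         (use S(1,3) abc(4,6) nb Sv out in auto)
  qed
  have T3: "has_T3 N m"
  proof -
    obtain u where u: "u \<in> U" using U_new by blast
    obtain p where p: "p \<in> N u \<inter> W" using other[OF u] by blast
    obtain q where q: "q \<in> N u \<inter> W" "q \<noteq> p" using other[OF u] by blast
    show ?thesis
    proof (cases "\<exists>u2\<in>U - {u}. \<exists>r\<in>N u2 \<inter> W. r \<notin> {p, q}")
      case True
      then obtain u2 r where r: "u2 \<in> U" "u2 \<noteq> u" "r \<in> N u2 \<inter> W" "r \<notin> {p, q}" by blast
      obtain u3 where u3: "u3 \<in> U" "u3 \<noteq> u" "u3 \<noteq> u2" using U_new by blast
      obtain s where s: "s \<in> N u3 \<inter> W" "s \<noteq> r" using other[OF u3(1)] by blast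
      \<comment> \<open>Of the neighbours \<open>p\<close>, \<open>q\<close> of \<open>u\<close>,
        one differs from the partner \<open>s\<close> of \<open>u3\<close>; both differ from
        \<open>r\<close>.\<close>
      define t where "t = (if s = p then q else p)"
      show ?thesis by (rule T3I[of t u r u2 s u3]) (use p q r s u u3 t_def in auto)
    next
      case False
      \<comment> \<open>Hall's condition fails only if all of \<open>U\<close> attaches to \<open>{p, q}\<close>, and then \<open>p\<close> has too large a degree.\<close>
      have pq: "N x \<inter> W = {p, q}" if "x \<in> U" "x \<noteq> u" for x
        by (rule card_seteq) (use False that two[OF that(1)] q in auto)
      obtain u2 where u2: "u2 \<in> U" "u2 \<noteq> u" using U_new by blast
      obtain u3 where u3: "u3 \<in> U" "u3 \<noteq> u" "u3 \<noteq> u2" using U_new by blast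
      have "card (N u2 \<inter> W) = 2" using pq[OF u2] q by simp
      \<comment> \<open>Two neighbours in \<open>W\<close> meet the bound \<open>to_W\<close> only
        for \<open>card W = m\<close>.\<close>
      then have cWm: "card W = m" using to_W[OF u2(1)] cW by simp
      show ?thesis
      proof (cases "\<exists>r\<in>N u \<inter> W. r \<notin> {p, q}")
        case True
        then obtain r where r: "r \<in> N u \<inter> W" "r \<notin> {p, q}" by blast
        show ?thesis
          by (rule T3I[of r u p u2 q u3]) (use r u u2 u3 q pq[OF u2] pq[OF u3(1,2)] in auto)
      next
        case False
        have no_U: "N x \<inter> W \<subseteq> {p, q}" if "x \<in> U" for x
          using False pq[OF that] by (cases "x = u") auto
        \<comment> \<open>Such a \<open>w\<close> has no neighbour in \<open>U\<close>, so only the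
          \<open>m\<close> vertices of \<open>insert v (W - {w})\<close> remain, and the minimum
          degree makes all of them neighbours, \<open>p\<close> included.\<close>
        have "p \<in> N w" if w: "w \<in> W - {p, q}" for w
        proof -
          have "w \<notin> N x" if "x \<in> U" for x using no_U[OF that] w by auto
          then have "N w \<inter> U = {}" using N_sym by blast
          then have sub: "N w \<subseteq> insert v (W - {w})" using N_sub[of w] by (auto simp: U_def)
          have "w \<in> V" using w WV by auto
          then have "N w = insert v (W - {w})"
            by (intro card_seteq[OF _ sub]) (use finW WV w cWm min_degree[of w] m_ge in auto)
          then show ?thesis using w p by auto
        qed
        moreover have "p \<in> N x" if "x \<in> U" for x using p pq[of x] that by (cases "x = u") auto
        \<comment> \<open>This gives \<open>p\<close> degree at least
          \<open>(m - 2) + (m - 1)\<close>, more than \<open>m + 2\<close>.\<close>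
        ultimately have "(W - {p, q}) \<union> U \<subseteq> N p" using N_sym by blast
        then have "card ((W - {p, q}) \<union> U) \<le> card (N p)" by (intro card_mono finite_N)
        moreover have "card ((W - {p, q}) \<union> U) = card (W - {p, q}) + card U"
          by (rule card_Un_disjoint) (use finW finU UW in auto)
        moreover have "card (W - {p, q}) = m - 2"
          using p q cWm finW by (simp add: card_Diff_subset)
        ultimately show ?thesis using bounded[of p] cU cWm m_ge by linarith
      qed
    qed
  qed
  from T2 T3 show ?thesis ..
qed

lemma has_T2_T3: "has_T2 N m \<and> has_T3 N m"
proof (cases "\<exists>v. m + 3 \<le> card (N v)")
  case True
  then show ?thesis using has_T2_T3_if_huge_degree by blast
next
  case False
  have "card (N x) \<le> m + 2" for x
  proof -
    have "\<not> m + 3 \<le> card (N x)" using False by blast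
    then show ?thesis by linarith
  qed
  then show ?thesis by (rule has_T2_T3_if_bounded_degree)
qed

end

section \<open>Copies of trees and Ramsey numbers\<close>

lemma edge_in_vertices:
  assumes "finite_simple_graph G" "{x, y} \<in> snd G"
  shows "x \<in> fst G \<and> y \<in> fst G \<and> x \<noteq> y"
proof -
  have "{x, y} \<in> [fst G]\<^bsup>2\<^esup>" using assms unfolding finite_simple_graph_def by blast
  then show ?thesis by simp
qed

text \<open>The copy consists of the images of edges of \<open>F\<close> only, so further edges of
  \<open>G\<close> among its vertices do not disturb the two-way condition in
  \<open>graph_isomorphic\<close>.\<close>

lemma contains_copyI:
  assumes F: "finite_simple_graph F" and f: "inj_on f (fst F)" "f ` fst F \<subseteq> fst G"
    and edges: "\<And>x y. {x, y} \<in> snd F \<Longrightarrow> {f x, f y} \<in> snd G"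
  shows "contains_copy G F"
proof -
  define H where "H = (f ` fst F, {{f x, f y} | x y. {x, y} \<in> snd F})"
  have inV: "x \<in> fst F \<and> y \<in> fst F \<and> x \<noteq> y" if "{x, y} \<in> snd F" for x y
    using edge_in_vertices[OF F that] .
  have "{f x, f y} \<in> [fst H]\<^bsup>2\<^esup>" if "{x, y} \<in> snd F" for x y
    using inV[OF that] inj_on_eq_iff[OF f(1)] by (simp add: H_def)
  then have "snd H \<subseteq> [fst H]\<^bsup>2\<^esup>" unfolding H_def by force
  moreover have "snd H \<subseteq> snd G" using edges unfolding H_def by force
  moreover have "finite (fst H)" "fst H \<subseteq> fst G"
    using F f(2) by (simp_all add: H_def finite_simple_graph_def)
  ultimately have "is_subgraph H G"
    by (simp add: is_subgraph_def finite_simple_graph_def)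
  moreover have "graph_isomorphic H F"
    unfolding graph_isomorphic_def
  proof (intro exI[of _ "inv_into (fst F) f"] conjI ballI)
    show "bij_betw (inv_into (fst F) f) (fst H) (fst F)"
      by (rule bij_betw_inv_into) (use f(1) in \<open>simp add: H_def bij_betw_def\<close>)
    fix x y assume "x \<in> fst H" "y \<in> fst H"
    then obtain a b where ab: "x = f a" "y = f b" "a \<in> fst F" "b \<in> fst F" by (auto simp: H_def)
    have "{x, y} \<in> snd H \<longleftrightarrow> {a, b} \<in> snd F"
    proof
      assume "{x, y} \<in> snd H"
      then have "\<exists>c d. {f a, f b} = {f c, f d} \<and> {c, d} \<in> snd F" by (simp add: H_def ab)
      then obtain c d where cd: "{f a, f b} = {f c, f d}" "{c, d} \<in> snd F" by blast
      have "f ` {a, b} = f ` {c, d}" using cd(1) by simp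
      then have "{a, b} = {c, d}"
        using inj_on_image_eq_iff[OF f(1), of "{a, b}" "{c, d}"] ab inV[OF cd(2)] by simp
      then show "{a, b} \<in> snd F" using cd by simp
    next
      assume "{a, b} \<in> snd F"
      then show "{x, y} \<in> snd H" unfolding H_def ab by auto
    qed
    then show "{x, y} \<in> snd H \<longleftrightarrow> {inv_into (fst F) f x, inv_into (fst F) f y} \<in> snd F"
      using ab f(1) by simp
  qed
  ultimately show ?thesis unfolding contains_copy_def by blast
qed

lemma contains_copyE:
  assumes "contains_copy G F"
  obtains f where "inj_on f (fst F)" "f ` fst F \<subseteq> fst G"
    "\<And>x y. x \<in> fst F \<Longrightarrow> y \<in> fst F \<Longrightarrow> {x, y} \<in> snd F \<Longrightarrow> {f x, f y} \<in> snd G"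
proof -
  from assms obtain H h where H: "is_subgraph H G" and h: "bij_betw h (fst H) (fst F)"
    and iso: "\<And>x y. x \<in> fst H \<Longrightarrow> y \<in> fst H \<Longrightarrow> {x, y} \<in> snd H \<longleftrightarrow> {h x, h y} \<in> snd F"
    unfolding contains_copy_def graph_isomorphic_def by blast
  define f where "f = inv_into (fst H) h"
  have f: "bij_betw f (fst F) (fst H)" unfolding f_def using h by (rule bij_betw_inv_into)
  have hf: "h (f x) = x" if "x \<in> fst F" for x
    using bij_betw_inv_into_right[OF h that] by (simp add: f_def)
  show ?thesis
  proof (rule that[of f])
    show "inj_on f (fst F)" using f by (simp add: bij_betw_def)
    show "f ` fst F \<subseteq> fst G" using f H by (simp add: bij_betw_def is_subgraph_def)
    fix x y assume xy: "x \<in> fst F" "y \<in> fst F" "{x, y} \<in> snd F"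
    then have "f x \<in> fst H" "f y \<in> fst H" using f by (auto simp: bij_betw_def)
    with xy have "{f x, f y} \<in> snd H" using iso hf by simp
    then show "{f x, f y} \<in> snd G" using H by (auto simp: is_subgraph_def)
  qed
qed

text \<open>The three trees differ only in the leaves \<open>i\<close>, \<open>j\<close>,
  \<open>k\<close> that carry the pendants, so copies are analysed once for the whole
  family.\<close>

definition star_with_pendants :: "nat \<Rightarrow> nat \<Rightarrow> nat \<Rightarrow> nat \<Rightarrow> nat sgraph" where
  "star_with_pendants m i j k =
     ({0..m + 3}, {{0, l} | l. l \<in> {1..m}} \<union> {{i, m + 1}, {j, m + 2}, {k, m + 3}})"

lemma trees_eq_star_with_pendants:
  shows "tree_T2 (m + 4) = star_with_pendants m 1 1 2"
    and "tree_T3 (m + 4) = star_with_pendants m 1 2 3"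
    and "double_star_T3 (m + 4) = star_with_pendants m m m m"
  by (simp_all add: tree_T2_def tree_T3_def double_star_T3_def star_with_pendants_def add.commute)

lemma nbhd_sym: "y \<in> nbhd E x \<longleftrightarrow> x \<in> nbhd E y"
  by (simp add: nbhd_def insert_commute)

text \<open>The embedding is list lookup: vertex \<open>l\<close> goes to position \<open>l\<close>
  of \<open>v # ys @ [x, y, z]\<close>, whence leaf \<open>i\<close> becomes
  \<open>ys ! (i - 1)\<close>.\<close>

lemma contains_star_with_pendants:
  assumes G: "finite_simple_graph G"
    and ys: "distinct ys" "length ys = m" "set ys \<subseteq> nbhd (snd G) v"
    and xyz: "distinct [x, y, z]" "{x, y, z} \<inter> insert v (set ys) = {}"
    and ijk: "i \<in> {1..m}" "j \<in> {1..m}" "k \<in> {1..m}"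
    and nb: "x \<in> nbhd (snd G) (ys ! (i - 1))" "y \<in> nbhd (snd G) (ys ! (j - 1))"
      "z \<in> nbhd (snd G) (ys ! (k - 1))"
  shows "contains_copy G (star_with_pendants m i j k)"
proof -
  define L where "L = v # ys @ [x, y, z]"
  have inV: "a \<in> fst G \<and> b \<in> fst G \<and> a \<noteq> b" if "a \<in> nbhd (snd G) b" for a b
    using edge_in_vertices[OF G, of b a] that by (auto simp: nbhd_def)
  have nth: "L ! 0 = v" "L ! (m + 1) = x" "L ! (m + 2) = y" "L ! (m + 3) = z"
    using ys(2) by (auto simp: L_def nth_append)
  have nthy: "L ! l = ys ! (l - 1)" if "l \<in> {1..m}" for l
    using that ys(2) by (cases l) (auto simp: L_def nth_append)
  have yl: "ys ! (l - 1) \<in> set ys" if "l \<in> {1..m}" for l using that ys(2) by auto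
  have dist: "distinct L" using ys xyz inV[of v v] by (auto simp: L_def)
  have "ys ! (i - 1) \<in> nbhd (snd G) v" using yl[OF ijk(1)] ys(3) by blast
  then have "v \<in> fst G" using inV by blast
  then have LV: "set L \<subseteq> fst G" using ys(3) inV nb by (auto simp: L_def)
  have len: "length L = m + 4" using ys(2) by (simp add: L_def)
  show ?thesis
  proof (rule contains_copyI[where f = "nth L"])
    show "finite_simple_graph (star_with_pendants m i j k)"
      using ijk by (auto simp: finite_simple_graph_def star_with_pendants_def)
    show "inj_on ((!) L) (fst (star_with_pendants m i j k))"
      using dist len by (auto simp: inj_on_def nth_eq_iff_index_eq star_with_pendants_def)
    show "(!) L ` fst (star_with_pendants m i j k) \<subseteq> fst G"
      using LV len by (auto simp: star_with_pendants_def)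
    fix a b assume "{a, b} \<in> snd (star_with_pendants m i j k)"
    moreover have "nth L ` e \<in> snd G" if e: "e \<in> snd (star_with_pendants m i j k)" for e
    proof -
      from e consider l where "l \<in> {1..m}" "e = {0, l}"
        | "e = {i, m + 1}" | "e = {j, m + 2}" | "e = {k, m + 3}"
        by (auto simp: star_with_pendants_def)
      then show ?thesis
      proof cases
        case 1
        then show ?thesis using nth nthy yl ys(3) by (auto simp: nbhd_def)
      qed (use nth nthy ijk nb in \<open>auto simp: nbhd_def\<close>)
    qed
    ultimately show "{L ! a, L ! b} \<in> snd G" by (metis image_empty image_insert)
  qed
qed

lemma contains_double_star:
  assumes G: "finite_simple_graph G" and m: "m \<ge> 1" and N: "has_double_star (nbhd (snd G)) m"
  shows "contains_copy G (double_star_T3 (m + 4))"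
proof -
  from N obtain v S a X where S: "S \<subseteq> nbhd (snd G) v" "card S = m" "a \<in> S"
    and X: "X \<subseteq> nbhd (snd G) a" "card X = 3" "X \<inter> insert v S = {}"
    unfolding has_double_star_def by blast
  obtain x y z where xyz: "X = {x, y, z}" "distinct [x, y, z]"
    using X(2) by (auto simp: card_Suc_eq numeral_3_eq_3)
  have finS: "finite S" using S(2) m card.infinite by fastforce
  obtain xs where xs: "set xs = S - {a}" "distinct xs"
    using finite_distinct_list[of "S - {a}"] finS by auto
  have len: "length xs = m - 1" using distinct_card[OF xs(2)] xs(1) S finS by simp
  \<comment> \<open>The second centre is leaf \<open>m\<close> of the numbering, so \<open>a\<close>
    comes last.\<close>
  define ys where "ys = xs @ [a]"
  have ys: "distinct ys" "length ys = m" "set ys = S" "ys ! (m - 1) = a"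
    using xs len S(3) m by (auto simp: ys_def nth_append)
  have "contains_copy G (star_with_pendants m m m m)"
    by (rule contains_star_with_pendants[OF G ys(1,2), where v = v and x = x and y = y and z = z])
       (use S(1) X(1,3) xyz(2) m in \<open>simp_all add: xyz(1) ys(3) ys(4)[simplified]\<close>)
  then show ?thesis by (simp add: trees_eq_star_with_pendants)
qed

lemma contains_T2:
  assumes G: "finite_simple_graph G" and m: "m \<ge> 2" and N: "has_T2 (nbhd (snd G)) m"
  shows "contains_copy G (tree_T2 (m + 4))"
proof -
  from N obtain v S a b x y z where S: "S \<subseteq> nbhd (snd G) v" "card S = m" "{a, b} \<subseteq> S" "a \<noteq> b"
    and X: "x \<in> nbhd (snd G) a" "y \<in> nbhd (snd G) a" "z \<in> nbhd (snd G) b"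
      "distinct [x, y, z]" "{x, y, z} \<inter> insert v S = {}"
    unfolding has_T2_def by (elim exE conjE) (rule that)
  have finS: "finite S" using S(2) m card.infinite by fastforce
  obtain xs where xs: "set xs = S - {a, b}" "distinct xs"
    using finite_distinct_list[of "S - {a, b}"] finS by auto
  have len: "length xs = m - 2"
    using distinct_card[OF xs(2)] xs(1) S finS by (simp add: card_Diff_subset)
  define ys where "ys = a # b # xs"
  have ys: "distinct ys" "length ys = m" "set ys = S"
    using xs len S(3,4) m by (auto simp: ys_def)
  have nth: "ys ! 0 = a" "ys ! 1 = b" by (simp_all add: ys_def)
  have "contains_copy G (star_with_pendants m 1 1 2)"
    by (rule contains_star_with_pendants[OF G ys(1,2), where v = v and x = x and y = y and z = z])
       (use S(1) X m nth in \<open>simp_all add: ys(3)\<close>)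
  then show ?thesis by (simp add: trees_eq_star_with_pendants)
qed

lemma contains_T3:
  assumes G: "finite_simple_graph G" and m: "m \<ge> 3" and N: "has_T3 (nbhd (snd G)) m"
  shows "contains_copy G (tree_T3 (m + 4))"
proof -
  from N obtain v S a b c x y z where S: "S \<subseteq> nbhd (snd G) v" "card S = m" "{a, b, c} \<subseteq> S"
      "distinct [a, b, c]"
    and X: "x \<in> nbhd (snd G) a" "y \<in> nbhd (snd G) b" "z \<in> nbhd (snd G) c"
      "distinct [x, y, z]" "{x, y, z} \<inter> insert v S = {}"
    unfolding has_T3_def by (elim exE conjE) (rule that)
  have finS: "finite S" using S(2) m card.infinite by fastforce
  obtain xs where xs: "set xs = S - {a, b, c}" "distinct xs"
    using finite_distinct_list[of "S - {a, b, c}"] finS by auto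
  have len: "length xs = m - 3"
    using distinct_card[OF xs(2)] xs(1) S finS by (simp add: card_Diff_subset)
  define ys where "ys = a # b # c # xs"
  have ys: "distinct ys" "length ys = m" "set ys = S"
    using xs len S(3,4) m by (auto simp: ys_def)
  have nth: "ys ! 0 = a" "ys ! 1 = b" "ys ! 2 = c" by (simp_all add: ys_def)
  have "contains_copy G (star_with_pendants m 1 2 3)"
    by (rule contains_star_with_pendants[OF G ys(1,2), where v = v and x = x and y = y and z = z])
       (use S(1) X m nth in \<open>simp_all add: ys(3)\<close>)
  then show ?thesis by (simp add: trees_eq_star_with_pendants)
qed

section \<open>Structure forced by a copy\<close>

lemma star_in_copy:
  assumes f: "inj_on f (fst (star_with_pendants m i j k))"
    and edges: "\<And>x y. x \<in> fst (star_with_pendants m i j k) \<Longrightarrow> y \<in> fst (star_with_pendants m i j k) \<Longrightarrow>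
      {x, y} \<in> snd (star_with_pendants m i j k) \<Longrightarrow> {f x, f y} \<in> E"
  shows "f ` {1..m} \<subseteq> nbhd E (f 0)" "card (f ` {1..m}) = m"
proof -
  have "{f 0, f l} \<in> E" if "l \<in> {1..m}" for l
    by (rule edges) (use that in \<open>auto simp: star_with_pendants_def\<close>)
  then show "f ` {1..m} \<subseteq> nbhd E (f 0)" by (auto simp: nbhd_def)
  have "inj_on f {1..m}" by (rule inj_on_subset[OF f]) (auto simp: star_with_pendants_def)
  then show "card (f ` {1..m}) = m" by (simp add: card_image)
qed

lemma finite_nbhd:
  assumes "finite_simple_graph G"
  shows "finite (nbhd (snd G) v)"
proof -
  have "nbhd (snd G) v \<subseteq> fst G"
    using edge_in_vertices[OF assms] by (auto simp: nbhd_def)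
  then show ?thesis using assms finite_subset by (auto simp: finite_simple_graph_def)
qed

lemma degree_ge_if_contains_star:
  assumes G: "finite_simple_graph G" and "contains_copy G (star_with_pendants m i j k)"
  shows "\<exists>v. m \<le> card (nbhd (snd G) v)"
  using assms(2)
proof (rule contains_copyE)
  fix f
  assume "inj_on f (fst (star_with_pendants m i j k))"
    and "\<And>x y. x \<in> fst (star_with_pendants m i j k) \<Longrightarrow> y \<in> fst (star_with_pendants m i j k) \<Longrightarrow>
      {x, y} \<in> snd (star_with_pendants m i j k) \<Longrightarrow> {f x, f y} \<in> snd G"
  note star = star_in_copy[OF this]
  have "m \<le> card (nbhd (snd G) (f 0))"
    using card_mono[OF finite_nbhd[OF G] star(1)] star(2) by simp
  then show ?thesis ..
qed

text \<open>Serves the extremal graph with a vertex of degree \<open>m\<close>, where degrees alone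
  do not exclude a copy.\<close>

lemma has_double_star_if_contains:
  assumes "m \<ge> 1" and "contains_copy G (double_star_T3 (m + 4))"
  shows "has_double_star (nbhd (snd G)) m"
proof -
  have "contains_copy G (star_with_pendants m m m m)"
    using assms by (simp add: trees_eq_star_with_pendants)
  then show ?thesis
  proof (rule contains_copyE)
    fix f
    assume f: "inj_on f (fst (star_with_pendants m m m m))"
      and edges: "\<And>x y. x \<in> fst (star_with_pendants m m m m) \<Longrightarrow> y \<in> fst (star_with_pendants m m m m) \<Longrightarrow>
        {x, y} \<in> snd (star_with_pendants m m m m) \<Longrightarrow> {f x, f y} \<in> snd G"
    note star = star_in_copy[OF f edges]
    have inj: "f a = f b \<longleftrightarrow> a = b" if "a \<le> m + 3" "b \<le> m + 3" for a b
      using inj_on_eq_iff[OF f] that by (simp add: star_with_pendants_def)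
    show ?thesis unfolding has_double_star_def
    proof (rule exI[of _ "f 0"], rule exI[of _ "f ` {1..m}"], rule exI[of _ "f m"],
        rule exI[of _ "{f (m + 1), f (m + 2), f (m + 3)}"], intro conjI star)
      show "f m \<in> f ` {1..m}" using assms(1) by simp
      show "{f (m + 1), f (m + 2), f (m + 3)} \<subseteq> nbhd (snd G) (f m)"
        using edges[of m "m + 1"] edges[of m "m + 2"] edges[of m "m + 3"]
        by (simp add: nbhd_def star_with_pendants_def)
      show "card {f (m + 1), f (m + 2), f (m + 3)} = 3" by (simp add: inj)
      show "{f (m + 1), f (m + 2), f (m + 3)} \<inter> insert (f 0) (f ` {1..m}) = {}"
        by (auto simp: inj)
    qed
  qed
qed

lemma contains_copy_mono:
  assumes "contains_copy G F" "fst G \<subseteq> fst G'" "snd G \<subseteq> snd G'"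
  shows "contains_copy G' F"
  using assms unfolding contains_copy_def is_subgraph_def by (meson order_trans)

text \<open>One graph on \<open>M - 1\<close> vertices rules out every \<open>N < M\<close>: its
  induced subgraphs inherit the absence of both trees, because the complement of an induced subgraph
  lies in the complement.\<close>

lemma ramsey_number_eqI:
  fixes G0 :: "nat sgraph"
  assumes M: "0 < M"
    and upper: "\<And>G :: nat sgraph. finite_simple_graph G \<Longrightarrow> card (fst G) = M \<Longrightarrow>
      contains_copy G F1 \<or> contains_copy (graph_compl G) F2"
    and G0: "finite_simple_graph G0" "card (fst G0) = M - 1" "\<not> contains_copy G0 F1"
      "\<not> contains_copy (graph_compl G0) F2"
  shows "ramsey_number F1 F2 = M"
  unfolding ramsey_number_def
proof (rule Least_equality)
  show "0 < M \<and> (\<forall>G :: nat sgraph. finite_simple_graph G \<and> card (fst G) = M \<longrightarrow>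
      contains_copy G F1 \<or> contains_copy (graph_compl G) F2)"
    using M upper by blast
next
  fix N
  assume N: "0 < N \<and> (\<forall>G :: nat sgraph. finite_simple_graph G \<and> card (fst G) = N \<longrightarrow>
      contains_copy G F1 \<or> contains_copy (graph_compl G) F2)"
  show "M \<le> N"
  proof (rule ccontr)
    assume "\<not> M \<le> N"
    then have "N \<le> card (fst G0)" using G0(2) by simp
    then obtain W where W: "W \<subseteq> fst G0" "card W = N"
      using obtain_subset_with_card_n by metis
    define G where "G = (W, {e \<in> snd G0. e \<subseteq> W})"
    have "finite W" using W G0(1) finite_subset by (auto simp: finite_simple_graph_def)
    then have "finite_simple_graph G"
      using G0(1) by (auto simp: finite_simple_graph_def G_def nsets_def)
    then have "contains_copy G F1 \<or> contains_copy (graph_compl G) F2"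
      using N W by (simp add: G_def)
    moreover have "snd (graph_compl G) \<subseteq> snd (graph_compl G0)"
      using W by (auto simp: graph_compl_def G_def nsets_def)
    ultimately show False
      using contains_copy_mono[of G F1 G0] contains_copy_mono[of "graph_compl G" F2 "graph_compl G0"]
        G0 W by (auto simp: graph_compl_def G_def)
  qed
qed

section \<open>Extremal graphs\<close>

text \<open>The relation \<open>adj x y\<close> is consulted only for \<open>x < y\<close>.\<close>

definition graph_below :: "nat \<Rightarrow> (nat \<Rightarrow> nat \<Rightarrow> bool) \<Rightarrow> nat sgraph" where
  "graph_below N adj = ({..<N}, {{x, y} | x y. x < y \<and> y < N \<and> adj x y})"

lemma graph_below_simple: "finite_simple_graph (graph_below N adj)"
  by (auto simp: finite_simple_graph_def graph_below_def)

lemma nbhd_graph_below: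
  "y \<in> nbhd (snd (graph_below N adj)) x \<longleftrightarrow>
     x < y \<and> y < N \<and> adj x y \<or> y < x \<and> x < N \<and> adj y x"
  by (auto simp: nbhd_def graph_below_def doubleton_eq_iff)

lemma graph_compl_below: "graph_compl (graph_below N adj) = graph_below N (\<lambda>x y. \<not> adj x y)"
proof -
  have "[{..<N}]\<^bsup>2\<^esup> - {{x, y} | x y. x < y \<and> y < N \<and> adj x y} =
      {{x, y} | x y. x < y \<and> y < N \<and> \<not> adj x y}"
    (is "_ - ?A = ?B")
  proof (intro equalityI subsetI)
    fix e assume e: "e \<in> [{..<N}]\<^bsup>2\<^esup> - ?A"
    then obtain x y where "e = {x, y}" "x < y" "y < N" by (auto simp: ordered_nsets_2_eq)
    with e show "e \<in> ?B" by blast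
  next
    fix e assume "e \<in> ?B"
    then obtain x y where xy: "e = {x, y}" "x < y" "y < N" "\<not> adj x y" by blast
    then have "e \<notin> ?A" by (auto simp: doubleton_eq_iff)
    with xy show "e \<in> [{..<N}]\<^bsup>2\<^esup> - ?A" by simp
  qed
  then show ?thesis by (simp add: graph_compl_def graph_below_def)
qed

definition sib :: "nat \<Rightarrow> nat" where
  "sib x = (if even x then x + 1 else x - 1)"

lemma eq_sib: "x \<noteq> y \<Longrightarrow> x div 2 = y div 2 \<Longrightarrow> y = sib x"
  unfolding sib_def by presburger

lemma sib_div2: "sib x div 2 = x div 2"
  unfolding sib_def by presburger

lemma sib_neq: "sib x \<noteq> x"
  unfolding sib_def by presburger

lemma sib_less: "x < 2 * k \<Longrightarrow> sib x < 2 * k"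
  unfolding sib_def by presburger

lemma card_le_insert:
  assumes "A \<subseteq> insert a C" "finite C"
  shows "card A \<le> Suc (card C)"
proof -
  have "card A \<le> card (insert a C)" using assms by (intro card_mono) auto
  also have "\<dots> \<le> Suc (card C)" using assms(2) by (simp add: card_insert_if)
  finally show ?thesis .
qed

text \<open>Here \<open>m = 2k + 1\<close> and the vertices are \<open>W = {..<2k}\<close>, a clique minus the perfect matching
  \<^const>\<open>sib\<close>; a clique \<open>U = {2k..<4k}\<close>, perfectly matched to \<open>W\<close>; and \<open>4k\<close>, joined to \<open>W\<close>.\<close>

definition adj_odd :: "nat \<Rightarrow> nat \<Rightarrow> nat \<Rightarrow> bool" where
  "adj_odd k x y \<longleftrightarrow>
     (if y < 2 * k then x div 2 \<noteq> y div 2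
      else if y < 4 * k then x < 2 * k \<longrightarrow> y = x + 2 * k
      else x < 2 * k)"

text \<open>In \<open>G\<close>, a vertex of \<open>W\<close> has \<open>2k - 2\<close> neighbours
  in \<open>W\<close>, one in \<open>U\<close>, and \<open>4k\<close>; a vertex of \<open>U\<close>
  has \<open>2k - 1\<close> in \<open>U\<close> and one in \<open>W\<close>. The complement gets the
  other half.\<close>

lemma degree_odd:
  fixes k x
  defines "G \<equiv> graph_below (4 * k + 1) (adj_odd k)"
  shows "card (nbhd (snd G) x) \<le> 2 * k \<and> card (nbhd (snd (graph_compl G)) x) \<le> 2 * k"
proof -
  let ?W = "{..<2 * k}" and ?U = "{2 * k..<4 * k}"
  note nb = nbhd_graph_below graph_compl_below G_def adj_odd_def
  consider "x < 2 * k" | "2 * k \<le> x" "x < 4 * k" | "x = 4 * k" | "4 * k < x" by linarith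
  then show ?thesis
  proof cases
    case 1
    have "nbhd (snd G) x \<subseteq> insert (4 * k) (insert (x + 2 * k) (?W - {x, sib x}))"
      using 1 sib_div2 by (auto simp: nb split: if_splits)
    then have "card (nbhd (snd G) x) \<le> Suc (card (insert (x + 2 * k) (?W - {x, sib x})))"
      by (rule card_le_insert) simp
    also have "\<dots> \<le> Suc (Suc (card (?W - {x, sib x})))"
      by (intro Suc_le_mono[THEN iffD2] card_le_insert[OF order_refl]) simp
    also have "\<dots> = 2 * k"
      using 1 sib_less[OF 1] sib_neq[of x] by (simp add: card_Diff_subset)
    finally have G: "card (nbhd (snd G) x) \<le> 2 * k" .
    have "nbhd (snd (graph_compl G)) x \<subseteq> insert (sib x) (?U - {x + 2 * k})"
      using 1 eq_sib[of x] by (auto simp: nb split: if_splits)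
    then have "card (nbhd (snd (graph_compl G)) x) \<le> Suc (card (?U - {x + 2 * k}))"
      by (rule card_le_insert) simp
    with G 1 show ?thesis by simp
  next
    case 2
    have "nbhd (snd G) x \<subseteq> insert (x - 2 * k) (?U - {x})"
      using 2 by (auto simp: nb split: if_splits)
    then have "card (nbhd (snd G) x) \<le> Suc (card (?U - {x}))" by (rule card_le_insert) simp
    moreover have "nbhd (snd (graph_compl G)) x \<subseteq> insert (4 * k) (?W - {x - 2 * k})"
      using 2 by (auto simp: nb split: if_splits)
    then have "card (nbhd (snd (graph_compl G)) x) \<le> Suc (card (?W - {x - 2 * k}))"
      by (rule card_le_insert) simp
    ultimately show ?thesis using 2 by simp
  next
    case 3
    have "nbhd (snd G) x \<subseteq> ?W" "nbhd (snd (graph_compl G)) x \<subseteq> ?U"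
      using 3 by (auto simp: nb split: if_splits)
    then show ?thesis
      using card_mono[of ?W "nbhd (snd G) x"] card_mono[of ?U "nbhd (snd (graph_compl G)) x"] by simp
  next
    case 4
    then have "nbhd (snd G) x = {}" "nbhd (snd (graph_compl G)) x = {}" by (auto simp: nb)
    then show ?thesis by simp
  qed
qed

text \<open>The non-edges inside \<open>W = {..<m}\<close> form a ladder with the rungs \<^const>\<open>sib\<close>, so its four corners
  miss two vertices of \<open>W\<close> and all others miss three. This is balanced by joining \<open>i \<in> W\<close> to
  those of \<open>m + i\<close>, \<open>m + i - 2\<close> that lie in the clique \<open>U = {m..<2m - 2}\<close>. The vertex \<open>2m - 2\<close> is
  joined to \<open>W\<close> and has the exceptional degree \<open>m\<close>.\<close>

definition adj_even :: "nat \<Rightarrow> nat \<Rightarrow> nat \<Rightarrow> bool" where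
  "adj_even m x y \<longleftrightarrow>
     (if y < m then x div 2 \<noteq> y div 2 \<and> y \<noteq> x + 2
      else if y < 2 * m - 2 then x < m \<longrightarrow> y = m + x \<or> y + 2 = m + x
      else x < m)"

text \<open>For \<open>x < m\<close> the neighbourhood in either colour is covered by one extra
  vertex and the image of a set of \<open>m - 2\<close> vertices; the map exchanges missing
  neighbours for their replacements.\<close>

lemma degree_even:
  fixes m x
  assumes m: "even m" "2 \<le> m"
  defines "G \<equiv> graph_below (2 * m - 1) (adj_even m)"
  shows "(x \<noteq> 2 * m - 2 \<longrightarrow> card (nbhd (snd G) x) \<le> m - 1) \<and>
    card (nbhd (snd (graph_compl G)) x) \<le> m - 1"
proof -
  let ?W = "{..<m}" and ?U = "{m..<2 * m - 2}"
  note nb = nbhd_graph_below graph_compl_below G_def adj_even_def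
  consider "x < m" | "m \<le> x" "x < 2 * m - 2" | "x = 2 * m - 2" | "2 * m - 2 < x" by linarith
  then show ?thesis
  proof cases
    case 1
    have sib: "sib x < m" using m(1) 1 sib_less[of x] by (auto elim!: evenE)
    \<comment> \<open>\<open>m + x\<close> exists exactly if the missing \<open>x + 2\<close> does, and \<open>m + x - 2\<close> exactly if \<open>x - 2\<close> does.\<close>
    define \<phi> where "\<phi> = (\<lambda>j. if j = x + 2 then m + x else if j + 2 = x then m + j else j)"
    have "nbhd (snd G) x \<subseteq> insert (2 * m - 2) (\<phi> ` (?W - {x, sib x}))"
    proof
      fix y assume y: "y \<in> nbhd (snd G) x"
      then consider "y < m" | "m \<le> y" "y < 2 * m - 2" | "y = 2 * m - 2" by (auto simp: nb) linarith+
      then show "y \<in> insert (2 * m - 2) (\<phi> ` (?W - {x, sib x}))"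
      proof cases
        case a: 1
        have "y = \<phi> y" "y \<in> ?W - {x, sib x}"
          using y a 1 sib_div2[of x] by (auto simp: nb \<phi>_def split: if_splits)
        then show ?thesis by blast
      next
        case a: 2
        have "y = m + x \<or> y + 2 = m + x" using y a 1 by (auto simp: nb split: if_splits)
        then show ?thesis
        proof
          assume "y = m + x"
          moreover have "x + 2 \<noteq> sib x" unfolding sib_def by auto
          ultimately have "y = \<phi> (x + 2)" "x + 2 \<in> ?W - {x, sib x}" using a by (auto simp: \<phi>_def)
          then show ?thesis by blast
        next
          assume b: "y + 2 = m + x"
          then have "2 \<le> x" using a by simp
          moreover have "x - 2 \<noteq> sib x" using sib_div2[of x] \<open>2 \<le> x\<close> unfolding sib_def by auto
          ultimately have "y = \<phi> (x - 2)" "x - 2 \<in> ?W - {x, sib x}" using a b 1 by (auto simp: \<phi>_def)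
          then show ?thesis by blast
        qed
      qed simp
    qed
    then have "card (nbhd (snd G) x) \<le> Suc (card (\<phi> ` (?W - {x, sib x})))"
      by (rule card_le_insert) simp
    also have "\<dots> \<le> Suc (card (?W - {x, sib x}))" by (simp add: card_image_le)
    also have "\<dots> = m - 1" using 1 sib sib_neq[of x] m(2) by (simp add: card_Diff_subset)
    finally have G: "card (nbhd (snd G) x) \<le> m - 1" .
    \<comment> \<open>In the complement the trade goes from \<open>U\<close> to \<open>W\<close>:
      the non-neighbours \<open>m + x\<close>, \<open>m + x - 2\<close> make room for
      \<open>x + 2\<close>, \<open>x - 2\<close>.\<close>
    define \<psi> where "\<psi> = (\<lambda>y. if y = m + x then x + 2 else if y + 2 = m + x then x - 2 else y)"
    have "nbhd (snd (graph_compl G)) x \<subseteq> insert (sib x) (\<psi> ` ?U)"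
    proof
      fix y assume y: "y \<in> nbhd (snd (graph_compl G)) x"
      then consider "y < m" | "m \<le> y" "y < 2 * m - 2" using 1 by (auto simp: nb split: if_splits)
      then show "y \<in> insert (sib x) (\<psi> ` ?U)"
      proof cases
        case a: 1
        have "y = sib x \<or> y = x + 2 \<or> x = y + 2"
          using y a 1 eq_sib[of x y] by (auto simp: nb)
        then consider "y = sib x" | "y = x + 2" | "x = y + 2" by blast
        then show ?thesis
        proof cases
          case b: 2
          then have "y = \<psi> (m + x)" "m + x \<in> ?U" using a by (auto simp: \<psi>_def)
          then show ?thesis by blast
        next
          case b: 3
          then have "y = \<psi> (m + y)" "m + y \<in> ?U" using a 1 by (auto simp: \<psi>_def)
          then show ?thesis by blast
        qed simp
      next
        case a: 2
        have "y = \<psi> y" "y \<in> ?U" using y a 1 by (auto simp: nb \<psi>_def)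
        then show ?thesis by blast
      qed
    qed
    then have "card (nbhd (snd (graph_compl G)) x) \<le> Suc (card (\<psi> ` ?U))"
      by (rule card_le_insert) simp
    also have "\<dots> \<le> Suc (card ?U)" using card_image_le[of ?U \<psi>] by simp
    also have "\<dots> = m - 1" using m(2) 1 by simp
    finally show ?thesis using G by simp
  next
    case 2
    \<comment> \<open>Both \<open>x - m\<close> and \<open>x + 2 - m\<close> lie in \<open>W\<close>
      because \<open>x < 2 * m - 2\<close>; they count for \<open>G\<close> here and are lost to the
      complement below.\<close>
    have "nbhd (snd G) x \<subseteq> insert (x - m) (insert (x + 2 - m) (?U - {x}))"
      using 2 by (auto simp: nb split: if_splits)
    then have "card (nbhd (snd G) x) \<le> Suc (card (insert (x + 2 - m) (?U - {x})))"
      by (rule card_le_insert) simp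
    also have "\<dots> \<le> Suc (Suc (card (?U - {x})))"
      by (intro Suc_le_mono[THEN iffD2] card_le_insert[OF order_refl]) simp
    also have "\<dots> \<le> m - 1" using 2 by simp
    finally have G: "card (nbhd (snd G) x) \<le> m - 1" .
    have "nbhd (snd (graph_compl G)) x \<subseteq> insert (2 * m - 2) (?W - {x - m, x + 2 - m})"
      using 2 by (auto simp: nb split: if_splits)
    then have "card (nbhd (snd (graph_compl G)) x) \<le> Suc (card (?W - {x - m, x + 2 - m}))"
      by (rule card_le_insert) simp
    also have "\<dots> = m - 1" using 2 by (simp add: card_Diff_subset)
    finally show ?thesis using G by simp
  next
    case 3
    have "nbhd (snd (graph_compl G)) x \<subseteq> ?U" using 3 m by (auto simp: nb split: if_splits)
    then show ?thesis
      using 3 card_mono[of ?U "nbhd (snd (graph_compl G)) x"] m(2) by simp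
  next
    case 4
    then have "nbhd (snd G) x = {}" "nbhd (snd (graph_compl G)) x = {}" by (auto simp: nb)
    then show ?thesis by simp
  qed
qed

text \<open>Only \<open>2 * m - 2\<close> can have degree \<open>m\<close>, so it is the centre and
  all of \<open>W\<close> its leaves. A leaf \<open>a\<close> then has at most \<open>m + a\<close>
  and \<open>m + a - 2\<close> left, too few for three pendants.\<close>

lemma no_double_star_even:
  assumes m: "even m" "2 \<le> m"
  shows "\<not> has_double_star (nbhd (snd (graph_below (2 * m - 1) (adj_even m)))) m"
proof
  let ?N = "nbhd (snd (graph_below (2 * m - 1) (adj_even m)))"
  assume "has_double_star ?N m"
  then obtain v S a X where S: "S \<subseteq> ?N v" "card S = m" "a \<in> S"
    and X: "X \<subseteq> ?N a" "card X = 3" "X \<inter> insert v S = {}"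
    unfolding has_double_star_def by blast
  have "m \<le> card (?N v)"
    using card_mono[OF finite_nbhd[OF graph_below_simple] S(1)] S(2) by simp
  then have v: "v = 2 * m - 2" using degree_even[OF m, of v] m by linarith
  have "?N v \<subseteq> {..<m}" using v by (auto simp: nbhd_graph_below adj_even_def split: if_splits)
  then have "S \<subseteq> {..<m}" using S(1) by blast
  then have SW: "S = {..<m}" using S(2) by (intro card_subset_eq) auto
  have "X \<subseteq> {m + a, m + a - 2}"
  proof
    fix y assume y: "y \<in> X"
    then have "y \<in> ?N a" "m \<le> y" "y \<noteq> 2 * m - 2" using X SW v by auto
    then show "y \<in> {m + a, m + a - 2}"
      using S(3) SW by (auto simp: nbhd_graph_below adj_even_def split: if_splits)
  qed
  then have "card X \<le> card {m + a, m + a - 2}" by (intro card_mono) auto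
  also have "\<dots> \<le> 2" by (simp add: card_insert_if)
  finally show False using X(2) by simp
qed

text \<open>Bounding the complement degrees excludes every choice of the second tree at once, so one
  graph serves all three Ramsey numbers.\<close>

lemma extremal_graph:
  assumes m: "2 \<le> m"
  obtains G :: "nat sgraph" where "finite_simple_graph G" "card (fst G) = 2 * m - 1"
    "\<not> has_double_star (nbhd (snd G)) m" "\<And>x. card (nbhd (snd (graph_compl G)) x) < m"
proof (cases "even m")
  case True
  show ?thesis
  proof (rule that[of "graph_below (2 * m - 1) (adj_even m)"])
    show "card (nbhd (snd (graph_compl (graph_below (2 * m - 1) (adj_even m)))) x) < m" for x
      using degree_even[OF True m, of x] m by linarith
  qed (use graph_below_simple no_double_star_even[OF True m] in \<open>auto simp: graph_below_def\<close>)
next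
  case False
  then obtain k where k: "m = 2 * k + 1" by (auto elim: oddE)
  let ?G = "graph_below (4 * k + 1) (adj_odd k)"
  show ?thesis
  proof (rule that[of ?G])
    show "finite_simple_graph ?G" by (rule graph_below_simple)
    show "card (fst ?G) = 2 * m - 1" using k by (simp add: graph_below_def)
    show "card (nbhd (snd (graph_compl ?G)) x) < m" for x using degree_odd[of k x] k by simp
    show "\<not> has_double_star (nbhd (snd ?G)) m"
    proof
      assume "has_double_star (nbhd (snd ?G)) m"
      then obtain v S where "S \<subseteq> nbhd (snd ?G) v" "card S = m"
        unfolding has_double_star_def by blast
      then have "m \<le> card (nbhd (snd ?G) v)"
        using card_mono[OF finite_nbhd[OF graph_below_simple]] by metis
      then show False using degree_odd[of k v] k by simp
    qed
  qed
qed

section \<open>Combining the upper and lower bounds\<close>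

lemma graph_compl_simple: "finite_simple_graph G \<Longrightarrow> finite_simple_graph (graph_compl G)"
  by (auto simp: finite_simple_graph_def graph_compl_def)

lemma nbhd_graph_compl:
  assumes "finite_simple_graph G"
  shows "y \<in> nbhd (snd (graph_compl G)) x \<longleftrightarrow>
    x \<in> fst G \<and> y \<in> fst G \<and> x \<noteq> y \<and> y \<notin> nbhd (snd G) x"
  by (auto simp: nbhd_def graph_compl_def)

lemma nbhd_sub:
  assumes "finite_simple_graph G" "y \<in> nbhd (snd G) x"
  shows "x \<in> fst G \<and> y \<in> fst G \<and> x \<noteq> y"
  using edge_in_vertices[OF assms(1)] assms(2) by (simp add: nbhd_def)

lemma trees_on_2m_vertices:
  assumes G: "finite_simple_graph G" and card: "card (fst G) = 2 * m" and m: "19 \<le> m"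
    and nods: "\<not> has_double_star (nbhd (snd G)) m"
  shows "has_all_trees (nbhd (snd (graph_compl G))) m"
proof -
  let ?R = "nbhd (snd G)" and ?B = "nbhd (snd (graph_compl G))"
  interpret two_colouring "fst G" ?R ?B m
  proof
    show "finite (fst G)" using G by (simp add: finite_simple_graph_def)
    show "card (fst G) = 2 * m" "19 \<le> m" by fact+
    show "y \<in> ?R x \<Longrightarrow> x \<in> ?R y" "y \<in> ?B x \<Longrightarrow> x \<in> ?B y" for x y by (simp_all add: nbhd_sym)
    show "?R x \<subseteq> fst G" "?B x \<subseteq> fst G" "?R x \<inter> ?B x = {}" for x
      using nbhd_sub[OF G] nbhd_graph_compl[OF G] by auto
    show "?R x \<union> ?B x = fst G - {x}" if "x \<in> fst G" for x
      using nbhd_sub[OF G] nbhd_graph_compl[OF G] that by auto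
  qed
  show ?thesis
  proof (cases "\<exists>v\<in>fst G. m \<le> card (?R v)")
    case True
    then show ?thesis using has_all_trees_if_big_vertex[OF nods] by blast
  next
    case False
    have deg: "m \<le> card (?B v)" if "v \<in> fst G" for v
    proof -
      have "card (?R v) < m" using False that by auto
      then show ?thesis using card_RB[OF that] by linarith
    qed
    interpret dense_graph "fst G" ?B m
    proof
      show "?B x \<subseteq> fst G - {x}" for x using nbhd_graph_compl[OF G] by auto
      show "y \<in> ?B x \<longleftrightarrow> x \<in> ?B y" for x y by (rule nbhd_sym)
    qed (use finite_V card_V m_ge deg in auto)
    \<comment> \<open>Every blue degree is at least \<open>m\<close>, so if blue had no double star,
      the result on big vertices with the colours exchanged would put one in red.\<close>
    have "has_double_star ?B m"
    proof (rule ccontr)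
      assume ds: "\<not> has_double_star ?B m"
      have "fst G \<noteq> {}" using card m by auto
      then obtain v where v: "v \<in> fst G" by blast
      have "has_all_trees ?R m"
        by (rule two_colouring.has_all_trees_if_big_vertex[OF swap_colours ds v deg[OF v]])
      with nods show False by (simp add: has_all_trees_def)
    qed
    with has_T2_T3 show ?thesis by (simp add: has_all_trees_def)
  qed
qed

text \<open>The lower bound is uniform in the second tree, so only the embedding of \<open>F\<close>
  is left as the premise \<open>upper\<close>.\<close>

lemma ramsey_number_double_star:
  assumes m: "19 \<le> m" and F: "F = star_with_pendants m i j k"
    and upper: "\<And>G :: nat sgraph. finite_simple_graph G \<Longrightarrow> has_all_trees (nbhd (snd G)) m \<Longrightarrow>
      contains_copy G F"
  shows "ramsey_number (double_star_T3 (m + 4)) F = 2 * m"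
proof -
  obtain G0 :: "nat sgraph" where G0: "finite_simple_graph G0" "card (fst G0) = 2 * m - 1"
    "\<not> has_double_star (nbhd (snd G0)) m" "\<And>x. card (nbhd (snd (graph_compl G0)) x) < m"
    using extremal_graph[of m] m by auto
  show ?thesis
  proof (rule ramsey_number_eqI[OF _ _ G0(1,2)])
    fix G :: "nat sgraph"
    assume G: "finite_simple_graph G" "card (fst G) = 2 * m"
    show "contains_copy G (double_star_T3 (m + 4)) \<or> contains_copy (graph_compl G) F"
      using contains_double_star[OF G(1)] trees_on_2m_vertices[OF G m]
        upper[OF graph_compl_simple[OF G(1)]] m by fastforce
  next
    show "\<not> contains_copy G0 (double_star_T3 (m + 4))"
      using has_double_star_if_contains[of m G0] G0(3) m by auto
    show "\<not> contains_copy (graph_compl G0) F"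
      using degree_ge_if_contains_star[OF graph_compl_simple[OF G0(1)]] G0(4) F
      by (meson not_le)
  qed (use m in simp)
qed

theorem theorem3p2:
  fixes n :: nat
  assumes "n > 22"
  shows "ramsey_number (double_star_T3 n) (tree_T2 n) = 2 * n - 8
       \<and> ramsey_number (double_star_T3 n) (tree_T3 n) = 2 * n - 8
       \<and> ramsey_number (double_star_T3 n) (double_star_T3 n) = 2 * n - 8"
proof -
  define m where "m = n - 4"
  have m: "19 \<le> m" "n = m + 4" "2 * n - 8 = 2 * m" using assms by (auto simp: m_def)
  note trees = trees_eq_star_with_pendants
  have "ramsey_number (double_star_T3 (m + 4)) (tree_T2 (m + 4)) = 2 * m"
    by (rule ramsey_number_double_star[OF m(1) trees(1)])
       (use contains_T2[where m = m] m in \<open>auto simp: has_all_trees_def\<close>)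
  moreover have "ramsey_number (double_star_T3 (m + 4)) (tree_T3 (m + 4)) = 2 * m"
    by (rule ramsey_number_double_star[OF m(1) trees(2)])
       (use contains_T3[where m = m] m in \<open>auto simp: has_all_trees_def\<close>)
  moreover have "ramsey_number (double_star_T3 (m + 4)) (double_star_T3 (m + 4)) = 2 * m"
    by (rule ramsey_number_double_star[OF m(1) trees(3)])
       (use contains_double_star[where m = m] m in \<open>auto simp: has_all_trees_def\<close>)
  ultimately show ?thesis using m by simp
qed

end
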